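(* Let $n\ge 1$ be an integer and let $A$ be a unital $C^*$-algebra with $\mathrm{sr}(A)>n$. Then there exists $b\in A^n$ such that $$\|b\|=\mathrm{dist}(b,\mathrm{lg}_n(A))=1.$$
   Context: Let $A$ be a unital $C^*$-algebra and $n\ge1$. Identify $A^n$ with the column space $M_{n,1}(A)$, with the norm $\|a\|=\|a^*a\|^{1/2}=\|\sum_{i\le n}a_i^*a_i\|^{1/2}$. The set $\mathrm{lg}_n(A)$ consists of all $a=(a_1,\dots,a_n)\in A^n$ with $A=Aa_1+\cdots+Aa_n$; equivalently, $a^*a=\sum_i a_i^*a_i$ is invertible in $A$. The stable rank $\mathrm{sr}(A)\in\{1,2,\dots,\infty\}$ is the smallest integer $n\ge 1$ such that $\mathrm{lg}_n(A)$ is norm dense in $A^n$, and $\mathrm{sr}(A)=\infty$ if there is no such $n$. For $b \in A^n$, $\mathrm{dist}(b,\mathrm{lg}_n(A))=\inf\{\|b-c\|: c\in \mathrm{lg}_n(A)\}$. *)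

theory Defs
  imports Complex_Main "HOL-Library.Extended_Nat"
begin

text \<open>
  Unital \<open>C\<^sup>*\<close>-algebras over the complex numbers. The superclass \<open>real_normed_algebra_1\<close> supplies the
  underlying real normed algebra with a submultiplicative norm, and also \<open>0 \<noteq> 1\<close> and
  \<open>norm 1 = 1\<close>. The latter follows from the \<open>C\<^sup>*\<close>-identity as soon as \<open>0 \<noteq> 1\<close>; so the only
  algebra left out is the zero algebra, which has stable rank 1.
\<close>

class unital_cstar_algebra = real_normed_algebra_1 + complete_space +
  fixes scaleC :: "complex \<Rightarrow> 'a \<Rightarrow> 'a"
    and star :: "'a \<Rightarrow> 'a"
  assumes scaleC_add_right: "scaleC c (x + y) = scaleC c x + scaleC c y"
    and scaleC_add_left: "scaleC (c + d) x = scaleC c x + scaleC d x"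
    and scaleC_scaleC: "scaleC c (scaleC d x) = scaleC (c * d) x"
    and scaleC_of_real: "scaleC (complex_of_real r) x = scaleR r x"
    and mult_scaleC_left: "scaleC c x * y = scaleC c (x * y)"
    and mult_scaleC_right: "x * scaleC c y = scaleC c (x * y)"
    and norm_scaleC: "norm (scaleC c x) = cmod c * norm x"
    and star_add: "star (x + y) = star x + star y"
    and star_scaleC: "star (scaleC c x) = scaleC (cnj c) (star x)"
    and star_mult: "star (x * y) = star y * star x"
    and star_star: "star (star x) = x"
    and cstar_identity: "norm (star x * x) = (norm x)\<^sup>2"

instantiation complex :: unital_cstar_algebra
begin

definition scaleC_complex :: "complex \<Rightarrow> complex \<Rightarrow> complex"
  where "scaleC_complex c x = c * x"

definition star_complex :: "complex \<Rightarrow> complex"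
  where "star_complex = cnj"

instance
  by standard
    (simp_all add: scaleC_complex_def star_complex_def algebra_simps scaleR_conv_of_real
      norm_mult power2_eq_square)

end

text \<open>
  Since \<open>n\<close> varies in the definition of the stable rank, \<open>A\<^sup>n\<close> is a carrier set rather than a type:
  the tuple \<open>(a\<^sub>1, \<dots>, a\<^sub>n)\<close> is the function with values \<open>a 0, \<dots>, a (n - 1)\<close>, extended by 0.
  The difference of two columns is the pointwise difference of functions.
\<close>

definition columns :: "nat \<Rightarrow> (nat \<Rightarrow> 'a::unital_cstar_algebra) set"
  where "columns n = {a. \<forall>i\<ge>n. a i = 0}"

definition col_norm :: "nat \<Rightarrow> (nat \<Rightarrow> 'a::unital_cstar_algebra) \<Rightarrow> real"
  where "col_norm n a = sqrt (norm (\<Sum>i<n. star (a i) * a i))"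

definition lg :: "nat \<Rightarrow> (nat \<Rightarrow> 'a::unital_cstar_algebra) set"
  where "lg n = {a \<in> columns n. \<forall>x. \<exists>c. x = (\<Sum>i<n. c i * a i)}"

definition col_dense :: "nat \<Rightarrow> (nat \<Rightarrow> 'a::unital_cstar_algebra) set \<Rightarrow> bool"
  where "col_dense n S \<longleftrightarrow> (\<forall>b\<in>columns n. \<forall>\<epsilon>>0. \<exists>c\<in>S. col_norm n (b - c) < \<epsilon>)"

text \<open>The infimum in \<^typ>\<open>enat\<close> is attained on nonempty sets, and is \<open>\<infinity>\<close> on the empty set.\<close>

definition stable_rank :: "'a::unital_cstar_algebra itself \<Rightarrow> enat"
  where "stable_rank _ = Inf {enat n | n. n \<ge> 1 \<and> col_dense n (lg n :: (nat \<Rightarrow> 'a) set)}"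

text \<open>Meaningful only for nonempty \<open>S\<close>; for \<open>n \<ge> 1\<close> the set \<open>lg n\<close> contains \<open>(1, 0, \<dots>, 0)\<close>.\<close>

definition col_dist :: "nat \<Rightarrow> (nat \<Rightarrow> 'a::unital_cstar_algebra) \<Rightarrow> (nat \<Rightarrow> 'a) set \<Rightarrow> real"
  where "col_dist n b S = (INF c\<in>S. col_norm n (b - c))"

end

theory Submission
  imports Defs
begin

text \<open>
  If \<open>a\<close> has distance at least \<open>\<alpha> > 0\<close> from \<open>lg\<^sub>n(A)\<close>, take \<open>0 < \<gamma> < \<alpha>\<close> and let
  \<open>b = a g\<close> with \<open>g = max(|a|, \<gamma>)\<^sup>-\<^sup>1\<close>. Then \<open>b\<^sup>*b \<le> 1\<close>, and \<open>b\<^sup>*b h = h\<close> for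
  \<open>h = max(|a|, \<gamma>) - \<gamma>\<close>, while \<open>a - b h = \<gamma> b\<close>. If some \<open>c\<close> in \<open>lg\<^sub>n(A)\<close> had distance
  less than 1 from \<open>b\<close>, an invertible matrix would carry it to some \<open>d\<close> in \<open>lg\<^sub>n(A)\<close> with
  \<open>d h = b h\<close>. As \<open>h + \<epsilon>\<close> is invertible, \<open>d (h + \<epsilon>)\<close> would lie in \<open>lg\<^sub>n(A)\<close> and approximate
  \<open>a\<close> up to \<open>\<gamma> < \<alpha>\<close>. The functional calculus is replaced by square roots of positive elements,
  where \<open>x\<close> is positive if it is selfadjoint with \<open>\<parallel>t - x\<parallel> \<le> t\<close> for some \<open>t\<close>; no spectral theory
  is needed.
\<close>

section \<open>The involution, and inverses near 1\<close>

instance unital_cstar_algebra \<subseteq> banach ..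

lemma star_zero [simp]: "star (0 :: 'a::unital_cstar_algebra) = 0"
  by (metis add_0 add_cancel_right_right star_add)

lemma star_one [simp]: "star (1 :: 'a::unital_cstar_algebra) = 1"
proof -
  have "star (star 1 * 1) = star (1::'a) * star (star 1)" by (rule star_mult)
  then show ?thesis by (simp add: star_star)
qed

lemma star_scaleR: "star (r *\<^sub>R x) = r *\<^sub>R star (x :: 'a::unital_cstar_algebra)"
  by (metis complex_cnj_complex_of_real scaleC_of_real star_scaleC)

lemma star_minus: "star (- x) = - star (x :: 'a::unital_cstar_algebra)"
  using star_scaleR[of "-1" x] by simp

lemma star_diff: "star (x - y) = star x - star (y :: 'a::unital_cstar_algebra)"
  using star_add[of x "- y"] by (simp add: star_minus)

lemma star_of_real [simp]: "star (of_real r) = (of_real r :: 'a::unital_cstar_algebra)"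
  by (simp add: of_real_def star_scaleR)

lemma star_sum: "star (sum f S) = (\<Sum>i\<in>S. star (f i :: 'a::unital_cstar_algebra))"
  by (induction S rule: infinite_finite_induct) (auto simp: star_add)

lemma star_inverse:
  fixes r s :: "'a::unital_cstar_algebra"
  assumes "r * s = 1" "star r = r"
  shows "star s = s"
proof -
  have "star (r * s) = 1" using assms(1) by simp
  then have "star s * r = 1" by (simp add: star_mult assms(2))
  then have "star s * r * s = s" by simp
  then show ?thesis by (simp add: mult.assoc assms(1))
qed

text \<open>The \<open>C\<^sup>*\<close>-identity gives one inequality; applied to both
  \<open>x\<close> and \<open>star x\<close> it gives equality.\<close>

lemma norm_star [simp]: "norm (star x) = norm (x :: 'a::unital_cstar_algebra)"
proof -
  have le: "norm y \<le> norm (star y)" for y :: 'a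
  proof (cases "y = 0")
    case False
    have "norm y * norm y \<le> norm (star y) * norm y"
      using cstar_identity[of y] norm_mult_ineq[of "star y" y] by (simp add: power2_eq_square)
    then show ?thesis using False by simp
  qed simp
  show ?thesis using le[of x] le[of "star x"] by (simp add: star_star)
qed

lemma star_mult_self_eq_0_iff [simp]:
  "star x * x = 0 \<longleftrightarrow> x = (0 :: 'a::unital_cstar_algebra)"
  using cstar_identity[of x] by auto

lemma square_eq_0_selfadjoint:
  "star x = x \<Longrightarrow> x * x = 0 \<Longrightarrow> x = (0 :: 'a::unital_cstar_algebra)"
  by (metis star_mult_self_eq_0_iff)

lemma tendsto_star [tendsto_intros]:
  assumes "(f \<longlongrightarrow> (l :: 'a::unital_cstar_algebra)) F"
  shows "((\<lambda>x. star (f x)) \<longlongrightarrow> star l) F"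
proof -
  have "((\<lambda>x. f x - l) \<longlongrightarrow> 0) F"
    using assms by (rule LIM_zero)
  then have "((\<lambda>x. norm (star (f x - l))) \<longlongrightarrow> 0) F"
    unfolding norm_star by (rule tendsto_norm_zero)
  then have "((\<lambda>x. star (f x - l)) \<longlongrightarrow> 0) F"
    by (rule tendsto_norm_zero_cancel)
  then show ?thesis
    unfolding star_diff by (rule LIM_zero_cancel)
qed

lemma neumann_inverse:
  fixes u :: "'a::{real_normed_algebra_1,banach}"
  assumes "norm (1 - u) < 1"
  obtains v where "u * v = 1" "v * u = 1"
proof -
  define x where "x = 1 - u"
  have s: "summable (\<lambda>n. x ^ n)"
    using assms complete_algebra_summable_geometric x_def by blast
  define v where "v = (\<Sum>n. x ^ n)"
  have split: "v = 1 + (\<Sum>n. x ^ Suc n)"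
    unfolding v_def using suminf_split_head[OF s] by simp
  have "(\<Sum>n. x ^ Suc n) = x * v" "(\<Sum>n. x ^ Suc n) = v * x"
    using suminf_mult[OF s, of x] suminf_mult2[OF s, of x]
    by (simp_all add: v_def power_commutes)
  with split have "v = 1 + x * v" "v = 1 + v * x" by simp_all
  then have "u * v = 1" "v * u = 1"
    by (simp_all add: x_def algebra_simps)
  then show ?thesis by (rule that)
qed

section \<open>Positive elements\<close>

text \<open>For selfadjoint \<open>x\<close> the bound says that the spectrum lies in
  \<open>[0, 2t]\<close>. In this form, closure under sums is the triangle inequality.\<close>

definition cpos :: "'a::unital_cstar_algebra \<Rightarrow> bool"
  where "cpos x \<longleftrightarrow> star x = x \<and> (\<exists>t. norm (of_real t - x) \<le> t)"

lemma cpos_star: "cpos x \<Longrightarrow> star x = x"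
  by (simp add: cpos_def)

lemma cpos_of_real: "0 \<le> r \<Longrightarrow> cpos (of_real r)"
  unfolding cpos_def by (auto intro!: exI[of _ r])

lemma cpos_add: assumes "cpos x" "cpos y" shows "cpos (x + y)"
proof -
  obtain s t where "norm (of_real s - x) \<le> s" "norm (of_real t - y) \<le> t"
    using assms by (auto simp: cpos_def)
  then have "norm ((of_real s - x) + (of_real t - y)) \<le> s + t"
    using norm_triangle_mono by blast
  moreover have "(of_real s - x) + (of_real t - y) = of_real (s + t) - (x + y)"
    by simp
  ultimately show ?thesis
    using assms unfolding cpos_def by (metis star_add)
qed

lemma cpos_sum: "(\<And>i. i \<in> S \<Longrightarrow> cpos (f i)) \<Longrightarrow> cpos (sum f S)"
  using cpos_of_real[of 0]
  by (induction S rule: infinite_finite_induct) (auto intro: cpos_add)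

lemma cpos_scaleR: assumes "cpos x" "0 \<le> r" shows "cpos (r *\<^sub>R x)"
proof -
  obtain t where "norm (of_real t - x) \<le> t"
    using assms by (auto simp: cpos_def)
  then have "norm (r *\<^sub>R (of_real t - x)) \<le> r * t"
    using assms by (simp add: mult_left_mono)
  moreover have "r *\<^sub>R (of_real t - x) = of_real (r * t) - r *\<^sub>R x"
    by (simp add: scaleR_diff_right of_real_def)
  ultimately show ?thesis
    using assms unfolding cpos_def by (metis star_scaleR)
qed

section \<open>Square roots of positive elements\<close>

text \<open>The iteration solving \<open>2q = z + q\<^sup>2\<close>, so that \<open>(1 - q)\<^sup>2 = 1 - z\<close>. It is dominated in norm by
  the same iteration for \<open>z = 1\<close>, which increases to 1.\<close>

fun sqrt_iter :: "'a::real_normed_algebra_1 \<Rightarrow> nat \<Rightarrow> 'a" where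
  "sqrt_iter z 0 = 0"
| "sqrt_iter z (Suc k) = (1/2) *\<^sub>R (z + sqrt_iter z k * sqrt_iter z k)"

lemma sqrt_iter_one:
  "0 \<le> sqrt_iter (1::real) k \<and> sqrt_iter (1::real) k \<le> sqrt_iter 1 (Suc k) \<and> sqrt_iter (1::real) k \<le> 1"
proof (induction k)
  case (Suc k)
  let ?s = "sqrt_iter (1::real) k" and ?s' = "sqrt_iter (1::real) (Suc k)"
  have "?s * ?s \<le> ?s' * ?s'" using Suc by (intro mult_mono) auto
  moreover have "?s * ?s \<le> 1 * 1" using Suc by (intro mult_mono) auto
  ultimately show ?case using Suc by simp
qed simp

lemma norm_sqrt_iter:
  fixes z :: "'a::real_normed_algebra_1"
  assumes "norm z \<le> 1"
  shows "norm (sqrt_iter z k) \<le> sqrt_iter 1 k"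
proof (induction k)
  case (Suc k)
  have "norm (z + sqrt_iter z k * sqrt_iter z k)
      \<le> 1 + sqrt_iter 1 k * sqrt_iter 1 k"
    using assms Suc sqrt_iter_one[of k]
    by (intro norm_triangle_mono order_trans[OF norm_mult_ineq] mult_mono) auto
  then show ?case by simp
qed simp

text \<open>Each iterate is a polynomial in \<open>z\<close>. The limit inherits the property, which
  later makes roots of commuting elements commute.\<close>

lemma sqrt_iter_commute:
  "v * z = z * v \<Longrightarrow> v * sqrt_iter z k = sqrt_iter z k * v"
proof (induction k)
  case (Suc k)
  then have "v * (sqrt_iter z k * sqrt_iter z k) = (sqrt_iter z k * sqrt_iter z k) * v"
    by (metis mult.assoc)
  then show ?case using Suc by (simp add: distrib_left distrib_right)
qed simp

text \<open>Consecutive iterates commute, so the difference of their squares factors, and each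
  factor is dominated by its scalar counterpart.\<close>

lemma norm_sqrt_iter_diff:
  fixes z :: "'a::real_normed_algebra_1"
  assumes "norm z \<le> 1"
  shows "norm (sqrt_iter z (Suc k) - sqrt_iter z k) \<le> sqrt_iter 1 (Suc k) - sqrt_iter 1 k"
proof (induction k)
  case 0
  then show ?case using assms by simp
next
  case (Suc k)
  define q q' where "q = sqrt_iter z k" and "q' = sqrt_iter z (Suc k)"
  define s s' where "s = sqrt_iter (1::real) k" and "s' = sqrt_iter (1::real) (Suc k)"
  have comm: "q * q' = q' * q"
    unfolding q_def q'_def
    by (rule sqrt_iter_commute, rule sqrt_iter_commute[symmetric], rule refl)
  have "sqrt_iter z (Suc (Suc k)) - sqrt_iter z (Suc k) = (1/2) *\<^sub>R (q' * q' - q * q)"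
    unfolding q_def q'_def by (simp add: algebra_simps)
  also have "\<dots> = (1/2) *\<^sub>R ((q' - q) * (q' + q))"
    using comm by (simp add: algebra_simps)
  finally have "norm (sqrt_iter z (Suc (Suc k)) - sqrt_iter z (Suc k))
      = norm ((q' - q) * (q' + q)) / 2" by simp
  moreover have "norm ((q' - q) * (q' + q)) \<le> (s' - s) * (s' + s)"
    using Suc norm_sqrt_iter[OF assms, of k] norm_sqrt_iter[OF assms, of "Suc k"]
      sqrt_iter_one[of k]
    unfolding q_def q'_def s_def s'_def
    by (intro order_trans[OF norm_mult_ineq] mult_mono norm_triangle_mono) auto
  moreover have "sqrt_iter 1 (Suc (Suc k)) - sqrt_iter 1 (Suc k) = (s' - s) * (s' + s) / 2"
    unfolding s_def s'_def by (simp add: algebra_simps)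
  ultimately show ?case by linarith
qed

text \<open>The scalar iteration is monotone and bounded, so its increments are summable; they
  dominate the increments for \<open>z\<close>, which telescope.\<close>

lemma sqrt_iter_convergent:
  fixes z :: "'a::{real_normed_algebra_1,banach}"
  assumes "norm z \<le> 1"
  shows "convergent (sqrt_iter z)"
proof -
  have "convergent (sqrt_iter (1::real))"
  proof (rule Bseq_mono_convergent)
    show "Bseq (sqrt_iter (1::real))"
      using sqrt_iter_one by (intro BseqI'[of _ 1]) simp
    show "\<forall>m n. m \<le> n \<longrightarrow> sqrt_iter (1::real) m \<le> sqrt_iter 1 n"
      using sqrt_iter_one lift_Suc_mono_le by blast
  qed
  then have "summable (\<lambda>k. sqrt_iter (1::real) (Suc k) - sqrt_iter 1 k)"
    using telescope_summable convergent_LIMSEQ_iff by blast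
  then have "summable (\<lambda>k. sqrt_iter z (Suc k) - sqrt_iter z k)"
    by (rule summable_comparison_test') (rule norm_sqrt_iter_diff[OF assms])
  then have "convergent (\<lambda>n. \<Sum>k<n. sqrt_iter z (Suc k) - sqrt_iter z k)"
    by (simp add: summable_iff_convergent)
  then show ?thesis by (simp only: sum_lessThan_telescope) (simp add: sqrt_iter.simps(1))
qed

lemma sqrt_one_minus_exists:
  fixes z :: "'a::unital_cstar_algebra"
  assumes "norm z \<le> 1" "star z = z"
  obtains q where "star q = q" "norm q \<le> 1" "(1 - q) * (1 - q) = 1 - z"
    "\<And>v. v * z = z * v \<Longrightarrow> v * q = q * v"
proof -
  obtain q where q: "sqrt_iter z \<longlonglongrightarrow> q"
    using sqrt_iter_convergent[OF assms(1)] by (auto simp: convergent_def)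
  have sa: "star (sqrt_iter z k) = sqrt_iter z k" for k
    by (induction k) (auto simp: star_scaleR star_add star_mult assms(2))
  have 1: "star q = q"
    using LIMSEQ_unique[OF tendsto_star[OF q, unfolded sa] q] .
  have "norm (sqrt_iter z k) \<le> 1" for k
    using norm_sqrt_iter[OF assms(1), of k] sqrt_iter_one[of k] by linarith
  then have 2: "norm q \<le> 1"
    using Lim_bounded[OF tendsto_norm[OF q], of 0 1] by auto
  have "(\<lambda>k. sqrt_iter z (Suc k)) \<longlonglongrightarrow> (1/2) *\<^sub>R (z + q * q)"
    unfolding sqrt_iter.simps by (intro tendsto_intros q)
  moreover have "(\<lambda>k. sqrt_iter z (Suc k)) \<longlonglongrightarrow> q"
    using q by (rule LIMSEQ_Suc)
  ultimately have "(1/2) *\<^sub>R (z + q * q) = q" by (rule LIMSEQ_unique)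
  then have "2 *\<^sub>R ((1/2) *\<^sub>R (z + q * q)) = 2 *\<^sub>R q" by (rule arg_cong)
  then have "z + q * q = q + q" by (simp add: scaleR_2)
  then have 3: "(1 - q) * (1 - q) = 1 - z" by (simp add: algebra_simps)
  have 4: "v * q = q * v" if "v * z = z * v" for v
  proof -
    have "(\<lambda>k. v * sqrt_iter z k) \<longlonglongrightarrow> v * q" "(\<lambda>k. sqrt_iter z k * v) \<longlonglongrightarrow> q * v"
      by (intro tendsto_intros q)+
    then show ?thesis
      using sqrt_iter_commute[OF that] LIMSEQ_unique by force
  qed
  show ?thesis using that 1 2 3 4 by blast
qed

text \<open>After division by \<open>t\<close>, \<open>x\<close> becomes \<open>1 - z\<close> with
  \<open>norm z \<le> 1\<close>, whose root is \<open>1 - q\<close>. The bound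
  \<open>norm q \<le> 1\<close> makes this root positive.\<close>

lemma cpos_sqrt:
  fixes x :: "'a::unital_cstar_algebra"
  assumes "cpos x"
  obtains w where "cpos w" "w * w = x" "\<And>v. v * x = x * v \<Longrightarrow> v * w = w * v"
proof -
  obtain t where t: "norm (of_real t - x) \<le> t" and sx: "star x = x"
    using assms by (auto simp: cpos_def)
  have "t \<ge> 0" using t norm_ge_zero[of "of_real t - x"] by linarith
  then consider "t = 0" | "t > 0" by linarith
  then show ?thesis
  proof cases
    case 1
    then have "x = 0" using t by simp
    then show ?thesis using that[of 0] cpos_of_real[of 0] by simp
  next
    case 2
    define z where "z = 1 - (1/t) *\<^sub>R x"
    have "z = (1/t) *\<^sub>R (of_real t - x)"
      using 2 by (simp add: z_def of_real_def scaleR_diff_right)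
    then have "norm z \<le> 1" using t 2 by simp
    moreover have "star z = z" by (simp add: z_def star_diff star_scaleR sx)
    ultimately obtain q where q: "star q = q" "norm q \<le> 1" "(1 - q) * (1 - q) = 1 - z"
      "\<And>v. v * z = z * v \<Longrightarrow> v * q = q * v"
      by (rule sqrt_one_minus_exists) blast
    define w where "w = sqrt t *\<^sub>R (1 - q)"
    have "cpos (1 - q)"
      unfolding cpos_def using q by (auto simp: star_diff intro!: exI[of _ 1])
    then have "cpos w" unfolding w_def by (rule cpos_scaleR) (use 2 in simp)
    moreover have "w * w = x"
      using 2 by (simp add: w_def q(3)) (simp add: z_def)
    moreover have "v * w = w * v" if "v * x = x * v" for v
    proof -
      have "v * z = z * v" using that by (simp add: z_def algebra_simps)
      then show ?thesis using q(4) by (simp add: w_def algebra_simps)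
    qed
    ultimately show ?thesis by (rule that)
  qed
qed

section \<open>Norm bounds, products and limits of positive elements\<close>

text \<open>The element \<open>u = y + iw\<close> satisfies \<open>star u * u = t\<^sup>2\<close>,
  so it has norm \<open>t\<close>, and \<open>y\<close> and \<open>w\<close> are its real and
  imaginary parts.\<close>

lemma norm_le_of_square_sum:
  fixes y w :: "'a::unital_cstar_algebra"
  assumes "star y = y" "star w = w" "y * w = w * y" "y * y + w * w = of_real (t\<^sup>2)" "0 \<le> t"
  shows "norm y \<le> t" "norm w \<le> t"
proof -
  define iw where "iw = scaleC \<i> w"
  define u where "u = y + iw"
  have siw: "star iw = - iw"
    using scaleC_of_real[of "-1" "scaleC \<i> w"]
    by (simp add: iw_def star_scaleC assms scaleC_scaleC)
  have iiw: "iw * iw = - (w * w)"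
    using scaleC_of_real[of "-1" "w * w"]
    by (simp add: iw_def mult_scaleC_left mult_scaleC_right scaleC_scaleC)
  have ciw: "y * iw = iw * y"
    by (simp add: iw_def mult_scaleC_left mult_scaleC_right assms)
  have su: "star u = y - iw" by (simp add: u_def star_add siw assms)
  have "star u * u = of_real (t\<^sup>2)"
    by (simp add: su) (simp add: u_def algebra_simps ciw iiw assms(4)[symmetric] flip: of_real_power)
  then have "(norm u)\<^sup>2 = t\<^sup>2"
    by (metis abs_of_nonneg cstar_identity norm_of_real zero_le_power2)
  then have nu: "norm u = t" using assms(5) by simp
  have "2 *\<^sub>R y = u + star u" "2 *\<^sub>R iw = u - star u"
    by (simp_all add: su) (simp_all add: u_def scaleR_2)
  then have "norm (2 *\<^sub>R y) \<le> t + t" "norm (2 *\<^sub>R iw) \<le> t + t"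
    using nu norm_triangle_ineq[of u "star u"] norm_triangle_ineq4[of u "star u"] by simp_all
  then show "norm y \<le> t" "norm w \<le> t" by (simp_all add: iw_def norm_scaleC)
qed

text \<open>After scaling to norm 1, \<open>1 - z\<^sup>2\<close> has a root \<open>w\<close> with
  \<open>z\<^sup>2 + w\<^sup>2 = 1\<close>. Hence \<open>norm w \<le> 1\<close>, so
  \<open>1 - z\<^sup>2 = w\<^sup>2\<close> has norm at most 1, which is positivity of
  \<open>z\<^sup>2\<close> with bound 1.\<close>

lemma cpos_square:
  fixes y :: "'a::unital_cstar_algebra"
  assumes "star y = y"
  shows "cpos (y * y)"
proof (cases "y = 0")
  case True
  then show ?thesis using cpos_of_real[of 0] by simp
next
  case False
  define z where "z = (1 / norm y) *\<^sub>R y"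
  have sz: "star z = z" by (simp add: z_def star_scaleR assms)
  have nz: "norm z = 1" using False by (simp add: z_def)
  have "cpos (1 - z * z)"
    unfolding cpos_def using sz nz norm_mult_ineq[of z z]
    by (auto simp: star_diff star_mult intro!: exI[of _ 1])
  then obtain w where w: "cpos w" "w * w = 1 - z * z"
    "\<And>v. v * (1 - z * z) = (1 - z * z) * v \<Longrightarrow> v * w = w * v"
    by (rule cpos_sqrt) blast
  have "z * w = w * z" by (rule w(3)) (simp add: algebra_simps)
  then have "norm w \<le> 1"
    using norm_le_of_square_sum(2)[of z w 1] sz cpos_star[OF w(1)] w(2) by simp
  then have "norm (1 - z * z) \<le> 1"
    using w(2) norm_mult_ineq[of w w] mult_le_one[of "norm w" "norm w"] by auto
  then have "cpos (z * z)"
    unfolding cpos_def using sz by (auto simp: star_mult intro!: exI[of _ 1])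
  then have "cpos ((norm y)\<^sup>2 *\<^sub>R (z * z))" by (rule cpos_scaleR) simp
  moreover have "(norm y)\<^sup>2 *\<^sub>R (z * z) = y * y"
    using False by (simp add: z_def power2_eq_square)
  ultimately show ?thesis by simp
qed

text \<open>The square roots commute as well, so the product is the square of the selfadjoint
  element \<open>v * w\<close>.\<close>

lemma cpos_mult:
  fixes x y :: "'a::unital_cstar_algebra"
  assumes "cpos x" "cpos y" "x * y = y * x"
  shows "cpos (x * y)"
proof -
  obtain v where v: "cpos v" "v * v = x" "\<And>u. u * x = x * u \<Longrightarrow> u * v = v * u"
    using cpos_sqrt[OF assms(1)] by blast
  obtain w where w: "cpos w" "w * w = y" "\<And>u. u * y = y * u \<Longrightarrow> u * w = w * u"
    using cpos_sqrt[OF assms(2)] by blast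
  have vw: "v * w = w * v" using v(3)[of y] w(3)[of v] assms(3) by simp
  have "star (v * w) = v * w" by (simp add: star_mult cpos_star v(1) w(1) vw)
  then have "cpos ((v * w) * (v * w))" by (rule cpos_square)
  moreover have "(v * w) * (v * w) = x * y"
    using vw v(2) w(2) by (metis mult.assoc)
  ultimately show ?thesis by simp
qed

text \<open>The product \<open>(t - x)(t + x) = t\<^sup>2 - x\<^sup>2\<close> is positive; its root
  \<open>w\<close> commutes with \<open>x\<close> and satisfies
  \<open>x\<^sup>2 + w\<^sup>2 = t\<^sup>2\<close>.\<close>

lemma norm_le_of_cpos:
  fixes x :: "'a::unital_cstar_algebra"
  assumes "cpos (of_real t - x)" "cpos (of_real t + x)" "0 \<le> t"
  shows "norm x \<le> t"
proof -
  have sx: "star x = x" using cpos_star[OF assms(2)] by (simp add: star_add)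
  have com: "of_real t * x = x * of_real t" by (simp add: of_real_def)
  have "cpos ((of_real t - x) * (of_real t + x))"
    by (intro cpos_mult assms) (simp add: algebra_simps com)
  moreover have "(of_real t - x) * (of_real t + x) = of_real (t\<^sup>2) - x * x"
    by (simp add: algebra_simps com power2_eq_square)
  ultimately obtain w where w: "cpos w" "w * w = of_real (t\<^sup>2) - x * x"
    "\<And>v. v * (of_real (t\<^sup>2) - x * x) = (of_real (t\<^sup>2) - x * x) * v \<Longrightarrow> v * w = w * v"
    using cpos_sqrt by metis
  have "x * w = w * x" by (rule w(3)) (simp add: of_real_def algebra_simps)
  then show ?thesis
    using norm_le_of_square_sum(1)[of x w t] sx cpos_star[OF w(1)] w(2) assms(3) by simp
qed

lemma cpos_antisym:
  fixes x :: "'a::unital_cstar_algebra"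
  assumes "cpos x" "cpos (- x)"
  shows "x = 0"
  using norm_le_of_cpos[of 0 x] assms by simp

lemma cpos_norm_minus:
  fixes x :: "'a::unital_cstar_algebra"
  assumes "star x = x" "norm x \<le> t"
  shows "cpos (of_real t - x)"
  unfolding cpos_def using assms by (auto simp: star_diff intro!: exI[of _ t])

text \<open>Replaces the unspecified bound in \<open>cpos\<close> by any bound on the norm; this
  uniformity lets positivity pass to limits.\<close>

lemma cpos_norm_diff_le:
  fixes x :: "'a::unital_cstar_algebra"
  assumes "cpos x" "norm x \<le> t"
  shows "norm (of_real t - x) \<le> t"
proof (rule norm_le_of_cpos)
  show "cpos (of_real t - (of_real t - x))" using assms by simp
  show "0 \<le> t" using assms(2) norm_ge_zero[of x] by linarith
  show "cpos (of_real t + (of_real t - x))"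
    using cpos_add[OF cpos_of_real[OF \<open>0 \<le> t\<close>] cpos_norm_minus[OF cpos_star[OF assms(1)] assms(2)]] .
qed

lemma cpos_limit:
  fixes x :: "'a::unital_cstar_algebra"
  assumes "\<And>e. e > 0 \<Longrightarrow> cpos (x + of_real e)"
  shows "cpos x"
proof -
  have sx: "star x = x" using cpos_star[OF assms[of 1]] by (simp add: star_add)
  have "norm (of_real (norm x + 1) - x) \<le> norm x + 1 + e" if "0 < e" "e < 1" for e
  proof -
    have "norm (x + of_real e) \<le> norm x + 1"
      using norm_triangle_ineq[of x "of_real e"] that by simp
    then have "norm (of_real (norm x + 1) - (x + of_real e)) \<le> norm x + 1"
      using assms that cpos_norm_diff_le by blast
    then have "norm ((of_real (norm x + 1) - (x + of_real e)) + of_real e) \<le> (norm x + 1) + e"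
      using that by (intro norm_triangle_mono) auto
    then show ?thesis by (simp add: algebra_simps)
  qed
  note bound = this
  have "norm (of_real (norm x + 1) - x) \<le> norm x + 1"
  proof (rule field_le_epsilon)
    fix e :: real assume "0 < e"
    then show "norm (of_real (norm x + 1) - x) \<le> norm x + 1 + e"
      using bound[of "min e (1/2)"] by linarith
  qed
  then show ?thesis using sx cpos_def by blast
qed

text \<open>In the order, \<open>z\<close> lies between \<open>\<delta>\<close> and
  \<open>t\<close>, so its distance to the midpoint \<open>s\<close> is less than \<open>s\<close>
  and the Neumann series applies. The inverse is positive because
  \<open>v = z * v\<^sup>2\<close>.\<close>

lemma cpos_inverse:
  fixes z :: "'a::unital_cstar_algebra"
  assumes "cpos (z - of_real \<delta>)" "\<delta> > 0"
  obtains v where "cpos v" "z * v = 1" "v * z = 1"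
proof -
  have sz: "star z = z" using cpos_star[OF assms(1)] by (simp add: star_diff)
  have pz: "cpos z" using cpos_add[OF assms(1) cpos_of_real[of \<delta>]] assms(2) by simp
  \<comment> \<open>The summand \<open>\<delta>\<close> keeps the half-width
    \<open>(t - \<delta>) / 2\<close> nonnegative.\<close>
  define t where "t = norm z + \<delta>"
  define s where "s = (t + \<delta>) / 2"
  have s: "s > 0" "(t - \<delta>) / 2 < s" "0 \<le> (t - \<delta>) / 2"
    using assms(2) norm_ge_zero[of z] by (auto simp: s_def t_def simp del: norm_ge_zero)
  have "norm (z - of_real s) \<le> (t - \<delta>) / 2"
  proof (rule norm_le_of_cpos)
    have s1: "(t - \<delta>) / 2 = t - s" and s2: "(t - \<delta>) / 2 = s - \<delta>"
      by (simp_all add: s_def field_simps)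
    have e1: "of_real ((t - \<delta>) / 2) - (z - of_real s) = of_real t - z"
      unfolding s1 by simp
    have e2: "of_real ((t - \<delta>) / 2) + (z - of_real s) = z - of_real \<delta>"
      unfolding s2 by simp
    show "cpos (of_real ((t - \<delta>) / 2) - (z - of_real s))"
      unfolding e1 using cpos_norm_minus[OF sz, of t] assms(2) by (simp add: t_def)
    show "cpos (of_real ((t - \<delta>) / 2) + (z - of_real s))"
      unfolding e2 by (rule assms)
  qed (use s in simp)
  then have "norm ((1/s) *\<^sub>R (z - of_real s)) < 1"
    unfolding norm_scaleR using s by (simp add: field_simps)
  moreover have "(1/s) *\<^sub>R (z - of_real s) = - (1 - (1/s) *\<^sub>R z)"
    using s by (simp add: of_real_def scaleR_diff_right)
  ultimately have "norm (1 - (1/s) *\<^sub>R z) < 1" by (simp only: norm_minus_cancel)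
  then obtain u where u: "((1/s) *\<^sub>R z) * u = 1" "u * ((1/s) *\<^sub>R z) = 1"
    by (rule neumann_inverse)
  define v where "v = (1/s) *\<^sub>R u"
  have v: "z * v = 1" "v * z = 1" using u by (simp_all add: v_def)
  have sv: "star v = v"
    using v(1) sz by (rule star_inverse)
  have "cpos (z * (v * v))"
    by (intro cpos_mult pz cpos_square sv) (simp add: v mult.assoc flip: mult.assoc[of z v v])
  moreover have "z * (v * v) = v" by (simp add: v flip: mult.assoc)
  ultimately show ?thesis using that v by simp
qed

lemma inverse_commute:
  fixes r s v :: "'a::monoid_mult"
  assumes "r * s = 1" "s * r = 1" "v * r = r * v"
  shows "v * s = s * v"
proof -
  have "v * s = s * (r * v) * s" using assms(2) by (simp flip: mult.assoc)
  also have "\<dots> = s * v * (r * s)" unfolding assms(3)[symmetric] by (simp add: mult.assoc)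
  finally show ?thesis using assms(1) by simp
qed

section \<open>Positive and negative parts\<close>

text \<open>Here \<open>k\<close> is the absolute value of \<open>y\<close>. Making it invertible as
  \<open>k' = k + e\<close> and setting \<open>u = k' + y\<close>, one has
  \<open>2uk' = u\<^sup>2 + (k'\<^sup>2 - y\<^sup>2)\<close>, a sum of positive elements;
  multiplying by the inverse of \<open>k'\<close> shows that \<open>u\<close> is positive.\<close>

lemma cpos_abs_add:
  fixes k y :: "'a::unital_cstar_algebra"
  assumes "cpos k" "star y = y" "k * k = y * y" "y * k = k * y"
  shows "cpos (k + y)"
proof (rule cpos_limit)
  fix e :: real assume e: "e > 0"
  define k' where "k' = k + of_real e"
  define u where "u = k' + y"
  have "cpos (k' - of_real e)" by (simp add: k'_def assms)
  then obtain v where v: "cpos v" "k' * v = 1" "v * k' = 1"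
    using cpos_inverse e by blast
  have su: "star u = u"
    using assms cpos_star[OF assms(1)] by (simp add: u_def k'_def star_add)
  define N where "N = u * u + ((2 * e) *\<^sub>R k + of_real (e\<^sup>2))"
  have N: "cpos N"
    unfolding N_def using e
    by (intro cpos_add cpos_square su cpos_scaleR assms cpos_of_real) auto
  have uk: "u * k' = k' * u"
    using assms(4) by (simp add: u_def k'_def algebra_simps of_real_def)
  have kk: "k' * k' = y * y + ((2 * e) *\<^sub>R k + of_real (e\<^sup>2))"
    by (simp add: k'_def algebra_simps assms(3) of_real_def power2_eq_square flip: scaleR_2)
  have yk: "y * k' = k' * y"
    using assms(4) by (simp add: k'_def algebra_simps of_real_def)
  have "N = u * u + (k' * k' - y * y)" using kk by (simp add: N_def)
  then have Nu: "N = 2 *\<^sub>R (u * k')"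
    using yk by (simp add: u_def algebra_simps scaleR_2)
  have "N * v = 2 *\<^sub>R u" using v by (simp add: Nu mult.assoc)
  moreover have "v * N = 2 *\<^sub>R u" using v by (simp add: Nu uk flip: mult.assoc)
  ultimately have "cpos (2 *\<^sub>R u)" using cpos_mult[OF N v(1)] by simp
  then have "cpos ((1/2) *\<^sub>R (2 *\<^sub>R u))" by (rule cpos_scaleR) simp
  then show "cpos (k + y + of_real e)" by (simp add: u_def k'_def algebra_simps)
qed

text \<open>The parts are \<open>(k + y)/2\<close> and \<open>(k - y)/2\<close> for the absolute
  value \<open>k\<close>; they are orthogonal because \<open>k\<^sup>2 = y\<^sup>2\<close> and
  \<open>k\<close> commutes with \<open>y\<close>.\<close>

lemma cpos_decomposition:
  fixes y :: "'a::unital_cstar_algebra"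
  assumes "star y = y"
  obtains p n where "cpos p" "cpos n" "y = p - n" "p * n = 0" "n * p = 0"
proof -
  obtain k where k: "cpos k" "k * k = y * y" "\<And>v. v * (y * y) = y * y * v \<Longrightarrow> v * k = k * v"
    using cpos_sqrt[OF cpos_square[OF assms]] by blast
  have yk: "y * k = k * y" by (rule k(3)) (simp add: mult.assoc)
  have "cpos (k + y)" by (rule cpos_abs_add[OF k(1) assms k(2) yk])
  moreover have "cpos (k + (- y))"
    by (rule cpos_abs_add) (simp_all add: k(1,2) yk assms star_minus)
  ultimately have "cpos ((1/2) *\<^sub>R (k + y))" "cpos ((1/2) *\<^sub>R (k - y))"
    using cpos_scaleR[of "k + y" "1/2"] cpos_scaleR[of "k + - y" "1/2"] by simp_all
  moreover have "y = (1/2) *\<^sub>R (k + y) - (1/2) *\<^sub>R (k - y)"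
  proof -
    have "(k + y) - (k - y) = 2 *\<^sub>R y" by (simp add: scaleR_2)
    then show ?thesis unfolding scaleR_diff_right[symmetric] by simp
  qed
  moreover have "((1/2) *\<^sub>R (k + y)) * ((1/2) *\<^sub>R (k - y)) = 0"
    "((1/2) *\<^sub>R (k - y)) * ((1/2) *\<^sub>R (k + y)) = 0"
  proof -
    have "(k + y) * (k - y) = 0" "(k - y) * (k + y) = 0"
      by (simp_all add: distrib_left distrib_right left_diff_distrib right_diff_distrib k(2) yk)
    then show "((1/2) *\<^sub>R (k + y)) * ((1/2) *\<^sub>R (k - y)) = 0"
      "((1/2) *\<^sub>R (k - y)) * ((1/2) *\<^sub>R (k + y)) = 0" by simp_all
  qed
  ultimately show ?thesis by (rule that)
qed

section \<open>Positivity of \<open>star a * a\<close>\<close>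

text \<open>Usually this is deduced from the fact that \<open>y\<^sup>*y\<close> and \<open>yy\<^sup>*\<close> have the same nonzero spectrum.
  Here, if \<open>y\<^sup>*y = -w\<^sup>2\<close>, then \<open>Y = yw\<close> satisfies \<open>Y\<^sup>*Y = -w\<^sup>4\<close> and \<open>YY\<^sup>* = -(yy\<^sup>*)\<^sup>2\<close>, whereas
  \<open>Y\<^sup>*Y + YY\<^sup>*\<close> is a positive combination of squares of the real and imaginary parts of \<open>Y\<close>.\<close>

lemma eq_0_of_cpos_minus:
  fixes y :: "'a::unital_cstar_algebra"
  assumes "cpos (- (star y * y))"
  shows "y = 0"
proof -
  obtain w where w: "cpos w" "w * w = - (star y * y)"
    using cpos_sqrt[OF assms] by blast
  note sw = cpos_star[OF w(1)]
  have yy: "star y * y = - (w * w)" using w(2) by simp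
  define Y s where "Y = y * w" and "s = y * star y"
  define r d where "r = Y + star Y" and "d = scaleC \<i> (Y - star Y)"
  have sYY: "star Y * Y = - ((w * w) * (w * w))"
  proof -
    have "star Y * Y = w * (star y * y) * w" by (simp add: Y_def star_mult sw mult.assoc)
    then show ?thesis by (simp add: yy mult.assoc)
  qed
  have YsY: "Y * star Y = - (s * s)"
  proof -
    have "Y * star Y = y * (w * w) * star y" by (simp add: Y_def star_mult sw mult.assoc)
    then show ?thesis by (simp add: w(2) s_def mult.assoc)
  qed
  have ss: "star s = s" by (simp add: s_def star_mult star_star)
  have sr: "star r = r" by (simp add: r_def star_add star_star add.commute)
  have "star d = scaleC (- \<i>) (star Y - Y)" by (simp add: d_def star_scaleC star_diff star_star)
  also have "\<dots> = scaleC \<i> (scaleC (of_real (-1)) (star Y - Y))" by (simp add: scaleC_scaleC)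
  also have "\<dots> = d" unfolding scaleC_of_real by (simp add: d_def)
  finally have sd: "star d = d" .
  have "d * d = scaleC (of_real (-1)) ((Y - star Y) * (Y - star Y))"
    by (simp add: d_def mult_scaleC_left mult_scaleC_right scaleC_scaleC)
  then have dd: "d * d = - ((Y - star Y) * (Y - star Y))"
    unfolding scaleC_of_real by simp
  have "r * r + d * d = 2 *\<^sub>R (star Y * Y + Y * star Y)"
    by (simp add: dd r_def algebra_simps scaleR_2)
  moreover have "cpos (r * r + d * d)" by (intro cpos_add cpos_square sr sd)
  ultimately have "cpos ((1/2) *\<^sub>R (2 *\<^sub>R (star Y * Y + Y * star Y)))"
    by (metis cpos_scaleR zero_le_divide_1_iff zero_le_numeral)
  \<comment> \<open>Adding \<open>s * s\<close> cancels \<open>Y * star Y\<close> and leaves the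
    negative of a square, so antisymmetry applies.\<close>
  then have "cpos (star Y * Y + Y * star Y + s * s)"
    using cpos_add cpos_square[OF ss] by force
  then have "cpos (- ((w * w) * (w * w)))" by (simp add: sYY YsY)
  moreover have sww: "star (w * w) = w * w" by (simp add: star_mult sw)
  ultimately have "(w * w) * (w * w) = 0"
    using cpos_antisym cpos_square by blast
  then have "w * w = 0" using square_eq_0_selfadjoint[OF sww] by blast
  then show ?thesis using yy by simp
qed

text \<open>For the negative part \<open>n\<close> of \<open>star a * a\<close>,
  \<open>star (a * n) * (a * n) = - n\<^sup>3\<close>. Hence \<open>a * n = 0\<close>, so
  \<open>n\<close> is nilpotent and selfadjoint, hence 0.\<close>

lemma cpos_star_mult_self: "cpos (star a * (a :: 'a::unital_cstar_algebra))"
proof -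
  have "star (star a * a) = star a * a" by (simp add: star_mult star_star)
  then obtain p n where pn: "cpos p" "cpos n" "star a * a = p - n" "p * n = 0" "n * p = 0"
    by (rule cpos_decomposition)
  note sn = cpos_star[OF pn(2)]
  have "star (a * n) * (a * n) = n * (star a * a) * n"
    by (simp add: star_mult sn mult.assoc)
  also have "\<dots> = - (n * (n * n))" by (simp add: pn(3) algebra_simps pn(4,5))
  finally have sz: "star (a * n) * (a * n) = - (n * (n * n))" .
  moreover have "cpos (n * (n * n))"
    by (intro cpos_mult pn cpos_square sn) (simp add: mult.assoc)
  ultimately have "a * n = 0" by (intro eq_0_of_cpos_minus) simp
  then have "n * (n * n) = 0" using sz by simp
  then have "(n * n) * (n * n) = 0" by (simp add: mult.assoc)
  then have "n * n = 0"
    by (rule square_eq_0_selfadjoint[rotated]) (simp add: star_mult sn)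
  then have "n = 0" by (rule square_eq_0_selfadjoint[OF sn])
  then show ?thesis using pn by simp
qed

section \<open>Columns and their inner product\<close>

text \<open>The product \<open>a\<^sup>*b\<close> of columns, that is, the \<open>A\<close>-valued
  inner product of the Hilbert module \<open>A\<^sup>n\<close>.\<close>

definition col_inner :: "nat \<Rightarrow> (nat \<Rightarrow> 'a::unital_cstar_algebra) \<Rightarrow> (nat \<Rightarrow> 'a) \<Rightarrow> 'a"
  where "col_inner n a b = (\<Sum>i<n. star (a i) * b i)"

lemma col_norm_sq: "(col_norm n a)\<^sup>2 = norm (col_inner n a a)"
  by (simp add: col_norm_def col_inner_def)

lemma col_norm_nonneg [simp]: "0 \<le> col_norm n a"
  by (simp add: col_norm_def)

lemma cpos_col_inner: "cpos (col_inner n a a)"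
  unfolding col_inner_def by (intro cpos_sum cpos_star_mult_self)

lemma star_col_inner: "star (col_inner n a b) = col_inner n b a"
  by (simp add: col_inner_def star_sum star_mult star_star)

lemma col_inner_diff_right:
  "col_inner n a (\<lambda>i. b i - c i) = col_inner n a b - col_inner n a c"
  by (simp add: col_inner_def right_diff_distrib sum_subtractf)

lemma col_inner_mult_right: "col_inner n a (\<lambda>i. b i * x) = col_inner n a b * x"
  by (simp add: col_inner_def sum_distrib_right mult.assoc)

lemma col_inner_mult_left: "col_inner n (\<lambda>i. a i * x) b = star x * col_inner n a b"
  by (simp add: col_inner_def sum_distrib_left mult.assoc star_mult)

lemma col_inner_diff_left:
  "col_inner n (\<lambda>i. a i - b i) c = col_inner n a c - col_inner n b c"
  by (simp add: col_inner_def left_diff_distrib sum_subtractf star_diff)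

text \<open>Cauchy-Schwarz for a contractive column: with \<open>v = b\<^sup>*e\<close>, positivity
  of the inner square of \<open>e - bv\<close> and of \<open>v\<^sup>*(1 - b\<^sup>*b)v\<close> add
  up to that of \<open>e\<^sup>*e - v\<^sup>*v\<close>.\<close>

lemma norm_col_inner_le:
  fixes b e :: "nat \<Rightarrow> 'a::unital_cstar_algebra"
  assumes "cpos (1 - col_inner n b b)"
  shows "norm (col_inner n b e) \<le> col_norm n e"
proof -
  define v where "v = col_inner n b e"
  define t where "t = norm (col_inner n e e)"
  obtain w where w: "cpos w" "w * w = 1 - col_inner n b b"
    using cpos_sqrt[OF assms] by blast
  have "star (w * v) * (w * v) = star v * (w * w) * v"
    by (simp add: star_mult cpos_star[OF w(1)] mult.assoc)
  then have "cpos (star v * (1 - col_inner n b b) * v)"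
    using cpos_star_mult_self[of "w * v"] w(2) by simp
  moreover have "cpos (col_inner n (\<lambda>i. e i - b i * v) (\<lambda>i. e i - b i * v))"
    by (rule cpos_col_inner)
  moreover have "col_inner n e b = star v" by (simp add: v_def star_col_inner)
  ultimately have "cpos (star v * (1 - col_inner n b b) * v +
      (col_inner n e e - star v * v - star v * (v - col_inner n b b * v)))"
    by (intro cpos_add)
      (simp_all add: col_inner_diff_left col_inner_diff_right col_inner_mult_left
        col_inner_mult_right v_def[symmetric] algebra_simps)
  then have "cpos (col_inner n e e - star v * v)" by (simp add: algebra_simps)
  then have "cpos ((of_real t - col_inner n e e) + (col_inner n e e - star v * v))"
    by (intro cpos_add cpos_norm_minus cpos_star[OF cpos_col_inner]) (simp_all add: t_def)
  then have "norm (star v * v) \<le> t"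
    by (intro norm_le_of_cpos) (auto intro!: cpos_add cpos_of_real cpos_star_mult_self simp: t_def)
  then have "(norm v)\<^sup>2 \<le> (col_norm n e)\<^sup>2" by (simp add: cstar_identity t_def col_norm_sq)
  then show ?thesis unfolding v_def by (rule power2_le_imp_le) simp
qed

section \<open>Left-generating columns\<close>

lemma lg_iff:
  "a \<in> lg n \<longleftrightarrow> a \<in> columns n \<and> (\<exists>c. (\<Sum>i<n. c i * a i) = 1)"
proof -
  have "\<exists>d. x = (\<Sum>i<n. d i * a i)" if "(\<Sum>i<n. c i * a i) = 1" for c x
  proof -
    have "x = x * (\<Sum>i<n. c i * a i)" using that by simp
    also have "\<dots> = (\<Sum>i<n. (x * c i) * a i)" by (simp add: sum_distrib_left mult.assoc)
    finally show ?thesis by (intro exI[of _ "\<lambda>i. x * c i"])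
  qed
  then show ?thesis unfolding lg_def by (auto; metis)
qed

lemma lg_mult_right:
  assumes "d \<in> lg n" "s * r = 1"
  shows "(\<lambda>i. d i * r) \<in> lg n"
proof -
  obtain c where c: "(\<Sum>i<n. c i * d i) = 1" and d: "d \<in> columns n"
    using assms by (auto simp: lg_iff)
  have "(\<Sum>i<n. (s * c i) * (d i * r)) = s * (\<Sum>i<n. c i * d i) * r"
    by (simp add: sum_distrib_left sum_distrib_right mult.assoc)
  then have "(\<Sum>i<n. (s * c i) * (d i * r)) = 1" using c assms(2) by simp
  then show ?thesis using d unfolding lg_iff by (auto simp: columns_def)
qed

text \<open>With \<open>e = b - c\<close>, the matrix \<open>Y = 1 - eb\<^sup>*\<close> is invertible because its norm distance to 1 is
  below 1, and \<open>Ybh = bh - e(b\<^sup>*b)h = ch\<close>. So \<open>d = Y\<^sup>-\<^sup>1c\<close> works; the formula for \<open>d\<close>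
  spells out \<open>Y\<^sup>-\<^sup>1 = 1 + e(1 - b\<^sup>*e)\<^sup>-\<^sup>1b\<^sup>*\<close>, which avoids matrices over \<open>A\<close>.\<close>

lemma lg_agree_on_peak:
  fixes b c :: "nat \<Rightarrow> 'a::unital_cstar_algebra"
  assumes b: "b \<in> columns n" "cpos (1 - col_inner n b b)"
    and c: "c \<in> lg n" "col_norm n (b - c) < 1"
    and h: "col_inner n b b * h = h"
  obtains d where "d \<in> lg n" "\<And>i. d i * h = b i * h"
proof -
  define e where "e = (\<lambda>i. b i - c i)"
  define C E where "C = col_inner n b c" and "E = col_inner n b e"
  have "norm E < 1"
    using norm_col_inner_le[OF b(2), of e] c(2) by (simp add: E_def e_def fun_diff_def)
  then have "norm (1 - (1 - E)) < 1" by simp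
  then obtain z where z: "(1 - E) * z = 1" "z * (1 - E) = 1" by (rule neumann_inverse)
  define d where "d = (\<lambda>i. c i + e i * (z * C))"
  have "C = col_inner n b b - E"
    by (simp add: C_def E_def e_def col_inner_diff_right)
  then have "C * h = (1 - E) * h" by (simp add: left_diff_distrib h)
  then have zCh: "z * C * h = h" by (metis mult.assoc mult_1 z(2))
  have 1: "d i * h = b i * h" for i
  proof -
    have "d i * h = c i * h + e i * (z * C * h)"
      by (simp add: d_def distrib_right mult.assoc)
    then show ?thesis unfolding zCh by (simp add: e_def left_diff_distrib)
  qed
  obtain l where l: "(\<Sum>i<n. l i * c i) = 1" and cc: "c \<in> columns n"
    using c by (auto simp: lg_iff)
  define L where "L = (\<Sum>i<n. l i * e i)"
  have ld: "(\<Sum>i<n. l i * d i) = 1 + L * (z * C)"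
    by (simp add: d_def L_def distrib_left sum.distrib l sum_distrib_right mult.assoc)
  have "col_inner n b d = C + E * (z * C)"
    by (simp add: d_def C_def E_def col_inner_def distrib_left sum.distrib sum_distrib_right mult.assoc)
  also have "\<dots> = z * C"
  proof -
    have "C = (1 - E) * z * C" using z by simp
    then show ?thesis by (simp add: algebra_simps)
  qed
  finally have bd: "(\<Sum>i<n. star (b i) * d i) = z * C" by (simp add: col_inner_def)
  \<comment> \<open>The row \<open>l - Lb\<^sup>*\<close> is \<open>lY\<close>, and
    \<open>lYd = lc = 1\<close>.\<close>
  have "(\<Sum>i<n. (l i - L * star (b i)) * d i) = (\<Sum>i<n. l i * d i) - L * (\<Sum>i<n. star (b i) * d i)"
    by (simp add: left_diff_distrib sum_subtractf sum_distrib_left mult.assoc)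
  also have "\<dots> = 1" by (simp add: ld bd)
  finally have "d \<in> lg n"
    using b(1) cc unfolding lg_iff by (auto simp: columns_def d_def e_def)
  then show ?thesis using that 1 by blast
qed

section \<open>Truncation from below\<close>

text \<open>In terms of functional calculus, \<open>R\<close> is \<open>max (\<surd>x) \<gamma>\<close> and \<open>g\<close> is its inverse.\<close>

lemma cpos_truncation:
  fixes x :: "'a::unital_cstar_algebra"
  assumes "cpos x" "\<gamma> > 0"
  obtains g R where "star g = g" "g * R = 1" "cpos (1 - g * x * g)"
    "g * x * g * (R - of_real \<gamma>) = R - of_real \<gamma>"
    "\<And>\<epsilon>. 0 < \<epsilon> \<Longrightarrow> \<epsilon> < \<gamma> \<Longrightarrow> \<exists>s. s * (R - of_real \<gamma> + of_real \<epsilon>) = 1"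
proof -
  have "star (x - of_real (\<gamma>\<^sup>2)) = x - of_real (\<gamma>\<^sup>2)"
    using cpos_star[OF assms(1)] by (simp add: star_diff del: of_real_power)
  then obtain p n where pn: "cpos p" "cpos n" "x - of_real (\<gamma>\<^sup>2) = p - n" "p * n = 0" "n * p = 0"
    by (rule cpos_decomposition)
  \<comment> \<open>As \<open>p\<close> is the positive part of \<open>x - \<gamma>\<^sup>2\<close>,
    \<open>m\<close> is the maximum of \<open>x\<close> and \<open>\<gamma>\<^sup>2\<close>.\<close>
  define m where "m = p + of_real (\<gamma>\<^sup>2)"
  have "cpos m" unfolding m_def by (intro cpos_add pn cpos_of_real) simp
  then obtain R where R: "cpos R" "R * R = m" "\<And>v. v * m = m * v \<Longrightarrow> v * R = R * v"
    using cpos_sqrt by blast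
  have "cpos (m - of_real (\<gamma>\<^sup>2))" by (simp add: m_def pn)
  then obtain mi where mi: "m * mi = 1" "mi * m = 1"
    using cpos_inverse[of m "\<gamma>\<^sup>2"] assms(2) by auto
  define g where "g = mi * R"
  have gR: "g * R = 1" by (simp add: g_def mult.assoc R(2) mi)
  have "R * mi = mi * R" by (rule inverse_commute[OF mi]) (simp add: mult.assoc flip: R(2))
  then have Rg: "R * g = 1" by (metis g_def R(2) mi(1) mult.assoc)
  have sR: "star R = R" by (rule cpos_star[OF R(1)])
  have sg: "star g = g" using Rg sR by (rule star_inverse)
  have nR: "n * R = R * n"
    by (rule R(3)) (simp add: m_def of_real_def algebra_simps pn)
  have ng: "n * g = g * n" by (rule inverse_commute[OF Rg gR nR])
  have "x = m - n" using pn(3) by (simp add: m_def algebra_simps)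
  then have gxg: "g * x * g = 1 - g * n * g"
    by (metis (no_types, lifting) Rg gR R(2) left_diff_distrib mult.assoc mult_1 right_diff_distrib)
  obtain q where q: "cpos q" "q * q = n" using cpos_sqrt[OF pn(2)] by blast
  have "star (q * g) * (q * g) = g * n * g"
    by (simp add: star_mult sg cpos_star[OF q(1)] mult.assoc flip: q(2))
  then have 1: "cpos (1 - g * x * g)"
    using cpos_star_mult_self[of "q * g"] gxg by simp
  \<comment> \<open>Used twice: \<open>\<delta> = \<gamma>\<close> exhibits
    \<open>R - \<gamma>\<close> as a right multiple of \<open>p\<close>, so \<open>n\<close>
    annihilates it; \<open>\<delta> = \<gamma> - \<epsilon>\<close> yields the left inverse of
    \<open>R - \<gamma> + \<epsilon>\<close>.\<close>
  have RR: "(R - of_real \<delta>) * (R + of_real \<delta>) = p + of_real (\<gamma>\<^sup>2 - \<delta>\<^sup>2)"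
     "(R + of_real \<delta>) * (R - of_real \<delta>) = p + of_real (\<gamma>\<^sup>2 - \<delta>\<^sup>2)" for \<delta>
    using R(2) by (simp_all add: m_def algebra_simps of_real_def power2_eq_square)
  obtain k where k: "(R + of_real \<gamma>) * k = 1"
    using cpos_inverse[of "R + of_real \<gamma>" \<gamma>] R(1) assms(2) by auto
  have "R - of_real \<gamma> = p * k"
    using RR(1)[of \<gamma>] k by (simp add: mult.assoc) (metis mult.assoc mult.right_neutral)
  then have "n * (R - of_real \<gamma>) = 0" using pn(5) by (simp flip: mult.assoc)
  then have "g * n * g * (R - of_real \<gamma>) = 0" using ng by (metis mult.assoc mult_zero_right)
  then have 2: "g * x * g * (R - of_real \<gamma>) = R - of_real \<gamma>"
    unfolding gxg by (simp add: left_diff_distrib)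
  have 3: "\<exists>s. s * (R - of_real \<gamma> + of_real \<epsilon>) = 1" if e: "0 < \<epsilon>" "\<epsilon> < \<gamma>" for \<epsilon>
  proof -
    define \<delta> where "\<delta> = \<gamma> - \<epsilon>"
    have "\<gamma>\<^sup>2 - \<delta>\<^sup>2 > 0" using e by (simp add: \<delta>_def power_strict_mono)
    then obtain v where "v * (p + of_real (\<gamma>\<^sup>2 - \<delta>\<^sup>2)) = 1"
      using cpos_inverse[of "p + of_real (\<gamma>\<^sup>2 - \<delta>\<^sup>2)" "\<gamma>\<^sup>2 - \<delta>\<^sup>2"] pn(1) by auto
    then have "v * (R + of_real \<delta>) * (R - of_real \<delta>) = 1"
      unfolding mult.assoc RR(2) .
    moreover have "R - of_real \<delta> = R - of_real \<gamma> + of_real \<epsilon>" by (simp add: \<delta>_def)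
    ultimately show ?thesis by metis
  qed
  show ?thesis using that[OF sg gR 1 2 3] .
qed

section \<open>Distance to the left-generating columns\<close>

lemma tendsto_col_norm_perturb:
  "((\<lambda>\<epsilon>. col_norm n (\<lambda>i. b i - \<epsilon> *\<^sub>R d i)) \<longlongrightarrow> col_norm n b) (at_right 0)"
proof -
  have "((\<lambda>\<epsilon>. col_norm n (\<lambda>i. b i - \<epsilon> *\<^sub>R d i)) \<longlongrightarrow> col_norm n (\<lambda>i. b i - 0 *\<^sub>R d i)) (at_right 0)"
    unfolding col_norm_def by (intro tendsto_intros)
  then show ?thesis by simp
qed

lemma unit_column_in_lg: "n \<ge> 1 \<Longrightarrow> (\<lambda>i. if i = 0 then 1 else 0) \<in> lg n"
  unfolding lg_iff columns_def
  by (auto intro!: exI[of _ "\<lambda>_. 1"] simp: sum.delta)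

text \<open>Small multiples of the first unit column lie in \<open>lg n\<close> and tend to
  0.\<close>

lemma col_dist_lg_le:
  assumes "n \<ge> 1"
  shows "col_dist n b (lg n) \<le> col_norm n b"
proof (rule tendsto_lowerbound[OF tendsto_col_norm_perturb])
  define u :: "nat \<Rightarrow> 'a" where "u = (\<lambda>i. if i = 0 then 1 else 0)"
  have u: "u \<in> lg n" unfolding u_def using assms by (rule unit_column_in_lg)
  have bdd: "bdd_below ((\<lambda>c. col_norm n (b - c)) ` lg n)" by (intro bdd_belowI2[of _ 0]) simp
  have "col_dist n b (lg n) \<le> col_norm n (\<lambda>i. b i - \<epsilon> *\<^sub>R u i)" if "0 < \<epsilon>" for \<epsilon>
  proof -
    have "(\<lambda>i. u i * of_real \<epsilon>) \<in> lg n"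
      by (rule lg_mult_right[OF u, of "of_real (1 / \<epsilon>)"]) (use that in \<open>simp add: of_real_def\<close>)
    then have "col_dist n b (lg n) \<le> col_norm n (b - (\<lambda>i. u i * of_real \<epsilon>))"
      unfolding col_dist_def by (rule cINF_lower[OF bdd])
    then show ?thesis by (simp add: fun_diff_def of_real_def)
  qed
  then show "\<forall>\<^sub>F \<epsilon> in at_right 0. col_dist n b (lg n) \<le> col_norm n (\<lambda>i. b i - \<epsilon> *\<^sub>R u i)"
    unfolding eventually_at_right_field by (auto intro: exI[of _ 1])
qed simp

theorem corollary0p4:
  fixes n :: nat
  assumes "n \<ge> 1"
    and "stable_rank TYPE('a::unital_cstar_algebra) > enat n"
  shows "\<exists>b::nat \<Rightarrow> 'a. b \<in> columns n \<and> col_norm n b = col_dist n b (lg n) \<and> col_dist n b (lg n) = 1"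
proof -
  have "\<not> col_dense n (lg n :: (nat \<Rightarrow> 'a) set)"
  proof
    assume "col_dense n (lg n :: (nat \<Rightarrow> 'a) set)"
    then have "stable_rank TYPE('a) \<le> enat n"
      unfolding stable_rank_def using assms(1) by (intro Inf_lower) auto
    then show False using assms(2) by simp
  qed
  then obtain a :: "nat \<Rightarrow> 'a" and \<alpha> where a: "a \<in> columns n" "\<alpha> > 0"
    "\<And>c. c \<in> lg n \<Longrightarrow> \<alpha> \<le> col_norm n (a - c)"
    unfolding col_dense_def by (meson not_less)
  define \<gamma> where "\<gamma> = \<alpha> / 2"
  have \<gamma>: "0 < \<gamma>" "\<gamma> < \<alpha>" using a(2) by (simp_all add: \<gamma>_def)
  obtain g R where g: "star g = g" "g * R = 1" "cpos (1 - g * col_inner n a a * g)"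
    "g * col_inner n a a * g * (R - of_real \<gamma>) = R - of_real \<gamma>"
    "\<And>\<epsilon>. 0 < \<epsilon> \<Longrightarrow> \<epsilon> < \<gamma> \<Longrightarrow> \<exists>s. s * (R - of_real \<gamma> + of_real \<epsilon>) = 1"
    using cpos_truncation[OF cpos_col_inner \<gamma>(1)] by metis
  define b where "b = (\<lambda>i. a i * g)"
  have b: "b \<in> columns n" using a(1) by (simp add: b_def columns_def)
  have bb: "col_inner n b b = g * col_inner n a a * g"
    by (simp add: b_def col_inner_mult_left col_inner_mult_right g(1) mult.assoc)
  have "norm (col_inner n b b) \<le> 1"
    using g(3) bb cpos_add[OF cpos_of_real[of 1] cpos_col_inner[of n b]]
    by (intro norm_le_of_cpos) auto
  then have b1: "col_norm n b \<le> 1" by (simp add: col_norm_def col_inner_def)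
  have far: "1 \<le> col_norm n (b - c)" if c: "c \<in> lg n" for c
  proof (rule ccontr)
    assume "\<not> 1 \<le> col_norm n (b - c)"
    then have "col_norm n (b - c) < 1" by simp
    then obtain d where d: "d \<in> lg n" "\<And>i. d i * (R - of_real \<gamma>) = b i * (R - of_real \<gamma>)"
      using lg_agree_on_peak[OF b _ c] g(3,4) unfolding bb by metis
    \<comment> \<open>With \<open>h = R - \<gamma>\<close>, this combines \<open>dh = bh\<close> and
      \<open>bR = a\<close>.\<close>
    have diff: "a i - d i * (R - of_real \<gamma> + of_real \<epsilon>) = \<gamma> *\<^sub>R b i - \<epsilon> *\<^sub>R d i" for i \<epsilon>
    proof -
      have "d i * (R - of_real \<gamma> + of_real \<epsilon>) = b i * (R - of_real \<gamma>) + \<epsilon> *\<^sub>R d i"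
        unfolding distrib_left d(2) by (simp add: of_real_def)
      also have "b i * (R - of_real \<gamma>) = a i - \<gamma> *\<^sub>R b i"
        by (simp add: b_def right_diff_distrib mult.assoc g(2)) (simp add: of_real_def)
      finally show ?thesis by simp
    qed
    \<comment> \<open>The gap between \<open>\<gamma>\<close> and \<open>\<alpha>\<close> absorbs
      the term \<open>\<epsilon> d\<close> once \<open>\<epsilon>\<close> is small.\<close>
    have "col_norm n (\<lambda>i. \<gamma> *\<^sub>R b i) = \<gamma> * col_norm n b"
      using \<gamma>(1) by (simp add: col_norm_def star_scaleR real_sqrt_mult flip: scaleR_sum_right)
    also have "\<dots> < \<alpha>" using mult_left_le[OF b1, of \<gamma>] \<gamma> by linarith
    finally have "\<forall>\<^sub>F \<epsilon> in at_right 0. col_norm n (\<lambda>i. \<gamma> *\<^sub>R b i - \<epsilon> *\<^sub>R d i) < \<alpha>"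
      by (rule order_tendstoD(2)[OF tendsto_col_norm_perturb])
    moreover have "\<forall>\<^sub>F \<epsilon> in at_right (0::real). 0 < \<epsilon> \<and> \<epsilon> < \<gamma>"
      unfolding eventually_at_right_field using \<gamma>(1) by auto
    ultimately have "\<forall>\<^sub>F \<epsilon> in at_right 0.
        col_norm n (\<lambda>i. \<gamma> *\<^sub>R b i - \<epsilon> *\<^sub>R d i) < \<alpha> \<and> 0 < \<epsilon> \<and> \<epsilon> < \<gamma>"
      by eventually_elim auto
    then obtain \<epsilon> where \<epsilon>: "col_norm n (\<lambda>i. \<gamma> *\<^sub>R b i - \<epsilon> *\<^sub>R d i) < \<alpha>" "0 < \<epsilon>" "\<epsilon> < \<gamma>"
      using eventually_happens'[of "at_right (0::real)"] trivial_limit_at_right_real by blast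
    obtain s where "s * (R - of_real \<gamma> + of_real \<epsilon>) = 1" using g(5) \<epsilon> by blast
    then have "\<alpha> \<le> col_norm n (a - (\<lambda>i. d i * (R - of_real \<gamma> + of_real \<epsilon>)))"
      by (intro a(3) lg_mult_right[OF d(1)])
    then show False using \<epsilon>(1) by (simp add: fun_diff_def diff)
  qed
  have "1 \<le> col_dist n b (lg n)"
    unfolding col_dist_def using far unit_column_in_lg[OF assms(1)] by (intro cINF_greatest) auto
  \<comment> \<open>The chain is 1 \<le> distance \<le> norm of \<open>b\<close> \<le> 1.\<close>
  with col_dist_lg_le[OF assms(1), of b] b1 b show ?thesis
    by (intro exI[of _ b]) auto
qed

end
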